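(* For every finite simple graph $G$, $M(G)\leq T^+(G)$.
   Context: Graphs are finite and simple. For a real symmetric $n\times n$ matrix $A=[a_{ij}]$, the graph of $A$ is the simple graph on vertices $1,\ldots,n$ where $\{i,j\}$ ($i\neq j$) is an edge if and only if $a_{ij}\neq 0$ (the diagonal entries are unrestricted). For a graph $G$ on $n$ vertices, $S(G)$ is the set of all $n\times n$ real symmetric matrices whose graph is $G$, and $M(G)$ is the maximum multiplicity of an eigenvalue of a matrix in $S(G)$; equivalently $M(G)=\max_{A\in S(G)}\operatorname{nullity}(A)$. The path cover number $P(G)$ is the minimum number of vertex-disjoint paths, each occurring as an induced subgraph of $G$, that cover all the vertices of $G$ (a single vertex counts as a path; the graph with no vertices has path cover number $0$). For a set $S$ of vertices of $G$, $G\setminus S$ is the induced subgraph obtained by deleting $S$. Define $$T^+(G)=\min\{P(G\setminus S)+|S| : S\subseteq V(G),\ G\setminus S \text{ is a forest}\}.$$ *)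

theory Defs
  imports
    "Graph_Theory.Graph_Theory"
    "Jordan_Normal_Form.Char_Poly"
    "HOL-Library.Disjoint_Sets"
begin

(* A finite simple graph is a digraph G satisfying the Graph_Theory locale "graph": finite,
   loopfree, without parallel arcs, and symmetric, so that an edge {u, v} is the pair of arcs
   from u to v and from v to u. The null graph is allowed. *)

definition matrix_graph :: "real mat \<Rightarrow> (nat, nat \<times> nat) pre_digraph" where
  "matrix_graph A =
     \<lparr> verts = {0..<dim_row A},
       arcs = {(i, j). i < dim_row A \<and> j < dim_row A \<and> i \<noteq> j \<and> A $$ (i, j) \<noteq> 0},
       tail = fst, head = snd \<rparr>"

(* The vertices of G are arbitrary, whereas those of matrix_graph A are 0, ..., n - 1; hence
   "the graph of A is G" is read up to isomorphism, i.e. up to the choice of an enumeration of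
   the vertices. *)
definition graph_matrices :: "('a, 'b) pre_digraph \<Rightarrow> real mat set" where
  "graph_matrices G =
     {A \<in> carrier_mat (card (verts G)) (card (verts G)).
        transpose_mat A = A \<and> digraph_iso G (matrix_graph A)}"

(* The multiplicities are bounded by the number of vertices (see finite_multiplicities), so the
   supremum is a maximum; only for the null graph is the set empty, and then Sup {} = 0, which is
   the nullity of the 0 x 0 matrix. *)
definition max_multiplicity :: "('a, 'b) pre_digraph \<Rightarrow> nat" where
  "max_multiplicity G =
     Sup {Polynomial.order x (char_poly A) | A x. A \<in> graph_matrices G \<and> eigenvalue A x}"

definition is_path_graph :: "('a, 'b) pre_digraph \<Rightarrow> bool" where
  "is_path_graph H \<longleftrightarrow>
     (\<exists>p. p \<noteq> [] \<and> distinct p \<and> verts H = set p \<and>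
        (\<forall>i < length p. \<forall>j < length p.
           (p ! i, p ! j) \<in> arcs_ends H \<longleftrightarrow> j = Suc i \<or> i = Suc j))"

definition is_path_cover :: "('a, 'b) pre_digraph \<Rightarrow> 'a set set \<Rightarrow> bool" where
  "is_path_cover G C \<longleftrightarrow>
     partition_on (verts G) C \<and> (\<forall>W \<in> C. is_path_graph (G \<restriction> W))"

definition path_cover_number :: "('a, 'b) pre_digraph \<Rightarrow> nat" where
  "path_cover_number G = (LEAST k. \<exists>C. is_path_cover G C \<and> card C = k)"

(* The predicate "forest" of Graph_Theory is about directed cycles: there the two arcs of a single
   edge already form a cycle. A cycle of an undirected graph has length at least 3. *)
definition is_forest :: "('a, 'b) pre_digraph \<Rightarrow> bool" where
  "is_forest G \<longleftrightarrow> \<not> (\<exists>p. pre_digraph.cycle G p \<and> 3 \<le> length p)"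

definition T_plus :: "('a, 'b) pre_digraph \<Rightarrow> nat" where
  "T_plus G =
     (LEAST k. \<exists>S. S \<subseteq> verts G \<and> is_forest (G \<restriction> (verts G - S)) \<and>
        k = path_cover_number (G \<restriction> (verts G - S)) + card S)"

lemma finite_multiplicities:
  "finite {Polynomial.order x (char_poly A) | A x. A \<in> graph_matrices G \<and> eigenvalue A x}"
proof (rule finite_subset)
  show "{Polynomial.order x (char_poly A) | A x. A \<in> graph_matrices G \<and> eigenvalue A x}
          \<subseteq> {..card (verts G)}"
  proof clarsimp
    fix A x assume "A \<in> graph_matrices G"
    then have A: "A \<in> carrier_mat (card (verts G)) (card (verts G))"
      by (simp add: graph_matrices_def)
    from degree_monic_char_poly[OF A] have "char_poly A \<noteq> 0" by auto
    from order_degree[OF this, of x] degree_monic_char_poly[OF A]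
    show "Polynomial.order x (char_poly A) \<le> card (verts G)" by simp
  qed
qed simp

lemma path_cover_exists:
  assumes "graph G"
  shows "\<exists>C. is_path_cover G C"
proof
  interpret graph G by fact
  have "is_path_graph (G \<restriction> {v})" for v
    unfolding is_path_graph_def
    by (rule exI[of _ "[v]"]) (auto simp: arcs_ends_conv dest: no_loops)
  then show "is_path_cover G ((\<lambda>v. {v}) ` verts G)"
    by (auto simp: is_path_cover_def partition_on_def disjoint_def)
qed

lemma forest_deletion_exists: "\<exists>S. S \<subseteq> verts G \<and> is_forest (G \<restriction> (verts G - S))"
proof (intro exI conjI)
  have "\<not> pre_digraph.cycle (G \<restriction> {}) p" for p
    by (simp add: pre_digraph.cycle_def pre_digraph.awalk_def)
  then show "is_forest (G \<restriction> (verts G - verts G))"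
    by (simp add: is_forest_def)
qed simp

end

theory Submission
  imports Defs "Jordan_Normal_Form.Jordan_Normal_Form_Uniqueness"
    "Jordan_Normal_Form.Jordan_Normal_Form_Existence"
begin

text \<open>
  Let \<open>A\<close> be a real symmetric matrix with graph \<open>G\<close>, let \<open>G \<setminus> S\<close> be a forest and take a cover of it
  by induced paths. The bound is a zero forcing argument: let \<open>Z\<close> consist of \<open>S\<close> and of the first
  vertex of every path. If \<open>A v = x v\<close> and \<open>v\<close> vanishes on \<open>Z\<close>, then \<open>v = 0\<close>, so the eigenspace
  embeds into the space of functions on \<open>Z\<close> (\<open>kernel_dim_le_card_coordinates\<close>) and its dimension
  is at most the number of paths plus \<open>|S|\<close>. Since \<open>A\<close> is symmetric, this dimension is the
  multiplicity of \<open>x\<close> as a root of the characteristic polynomial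
  (\<open>order_char_poly_symmetric\<close>). As such a \<open>v\<close> is zero on \<open>S\<close>, its restriction to
  \<open>G \<setminus> S\<close> is a null vector of a principal submatrix of \<open>A - x I\<close>, whose graph is that forest.

  The combinatorial core is that a null vector on a forest that is zero at the first vertex of
  every path is zero (\<open>null_vector_zero_of_path_heads\<close>). Otherwise, walk backwards
  along a path on which the vector is not zero, until the last vertex \<open>u\<close> before its first nonzero
  entry. In the equation at \<open>u\<close> a nonzero term cannot stand alone, and since the path is induced,
  the second one comes from a vertex on another path, on which the vector is not zero either.
  Continue there. This walk never turns back along the edge it has just used, and the graph is
  finite, so it runs into a cycle (\<open>not_forest_if_successor\<close>), which a forest does not have.
\<close>

section \<open>Dimension of null spaces\<close>

text \<open>The coordinate projection to \<open>Z\<close> is injective on the null space, so it maps a basis to a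
  linearly independent family in a space of dimension \<open>|Z|\<close>.\<close>

lemma kernel_dim_le_card_coordinates:
  fixes A :: "'a :: field mat"
  assumes A: "A \<in> carrier_mat nr nc" and Z: "Z \<subseteq> {..<nc}"
    and vanish: "\<And>v. v \<in> mat_kernel A \<Longrightarrow> (\<And>i. i \<in> Z \<Longrightarrow> v $ i = 0) \<Longrightarrow> v = 0\<^sub>v nc"
  shows "kernel_dim A \<le> card Z"
proof -
  interpret kernel nr nc A by unfold_locales (rule A)
  have finZ: "finite Z" using Z finite_subset by blast
  define zs where "zs = sorted_list_of_set Z"
  have zs: "set zs = Z" "length zs = card Z" using finZ by (auto simp: zs_def)
  define T where "T = (\<lambda>v :: 'a vec. vec (card Z) (\<lambda>k. v $ (zs ! k)))"
  interpret W: vec_space "TYPE('a)" "card Z" .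
  obtain B where finB: "finite B" and B: "basis B"
    using kernel_basis_exists[OF A] by blast
  have BK: "B \<subseteq> mat_kernel A" and Bli: "lin_indpt B"
    using B unfolding Ker.basis_def by auto
  have Z_index: "\<exists>k < card Z. zs ! k = i" if "i \<in> Z" for i
    using that zs by (metis in_set_conv_nth)
  have zs_less: "zs ! k < nc" if "k < card Z" for k
    using that zs Z nth_mem by fastforce
  have inj: "inj_on T B"
  proof (rule inj_onI)
    fix u v assume u: "u \<in> B" and v: "v \<in> B" and eq: "T u = T v"
    have uv: "u \<in> carrier_vec nc" "v \<in> carrier_vec nc"
      using u v BK mat_kernelD[OF A] by blast+
    have "u - v \<in> mat_kernel A"
    proof (rule mat_kernelI[OF A])
      show "A *\<^sub>v (u - v) = 0\<^sub>v nr"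
        using mult_minus_distrib_mat_vec[OF A uv] mat_kernelD(2)[OF A subsetD[OF BK u]]
          mat_kernelD(2)[OF A subsetD[OF BK v]] by simp
    qed (use uv in simp)
    moreover have "(u - v) $ i = 0" if i: "i \<in> Z" for i
    proof -
      obtain k where k: "k < card Z" "zs ! k = i" using Z_index[OF i] by blast
      have "u $ i = v $ i" using arg_cong[OF eq, of "\<lambda>w. w $ k"] k by (simp add: T_def)
      then show ?thesis using uv i Z by (auto simp: subset_iff)
    qed
    ultimately have "u - v = 0\<^sub>v nc" by (rule vanish)
    then have "(u - v) $ i = 0" if "i < nc" for i using that by simp
    then show "u = v" using uv by (intro eq_vecI) auto
  qed
  have "W.lin_indpt (T ` B)"
  proof (rule W.finite_lin_indpt2)
    fix a :: "'a vec \<Rightarrow> 'a" assume lc: "W.lincomb a (T ` B) = 0\<^sub>v (card Z)"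
    let ?w = "lincomb (a \<circ> T) B"
    have "?w = 0\<^sub>v nc"
    proof (rule vanish)
      show "?w \<in> mat_kernel A" using Ker.lincomb_closed[OF BK] by auto
      fix i assume i: "i \<in> Z"
      obtain k where k: "k < card Z" "zs ! k = i" using Z_index[OF i] by blast
      have "?w $ i = (\<Sum>v\<in>B. a (T v) * v $ i)"
        using lincomb_index[OF _ BK] i Z by (auto simp: subset_iff)
      also have "\<dots> = (\<Sum>v\<in>B. a (T v) * T v $ k)"
        using k by (simp add: T_def)
      also have "\<dots> = (\<Sum>y\<in>T ` B. a y * y $ k)"
        by (simp add: sum.reindex[OF inj])
      also have "\<dots> = W.lincomb a (T ` B) $ k"
        using k by (subst W.lincomb_index) (auto simp: T_def)
      finally show "?w $ i = 0" using lc k by simp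
    qed
    then have "a \<circ> T \<in> B \<rightarrow> {0}"
      using Ker.not_lindepD[OF Bli finB subset_refl] by auto
    then show "\<forall>v\<in>T ` B. a v = 0" by auto
  qed (auto simp: finB T_def)
  moreover have "T ` B \<subseteq> carrier_vec (card Z)" by (auto simp: T_def)
  ultimately have "card (T ` B) \<le> card Z"
    using W.li_le_dim(2)[OF W.fin_dim, of "T ` B"] W.dim_is_n by simp
  then show ?thesis
    using card_image[OF inj] Ker.dim_basis[OF finB B] by simp
qed

section \<open>Eigenvalues of real symmetric matrices\<close>

lemma conjugate_mult_mat_vec:
  fixes A :: "'a :: conjugatable_ring mat"
  assumes A: "A \<in> carrier_mat n m" and v: "v \<in> carrier_vec m"
  shows "conjugate (A *\<^sub>v v) = map_mat conjugate A *\<^sub>v conjugate v"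
  by (rule eq_vecI) (use A v in \<open>auto simp: scalar_prod_def sum_conjugate conjugate_dist_mul\<close>)

text \<open>With \<open>w = C v\<close>, self-adjointness gives \<open>\<langle>w, w\<rangle> = \<langle>v, C w\<rangle> = 0\<close>.\<close>
lemma mult_mat_vec_twice_eq_0:
  fixes C :: "complex mat"
  assumes C: "C \<in> carrier_mat n n" and sym: "transpose_mat C = C" and real: "map_mat conjugate C = C"
    and v: "v \<in> carrier_vec n" and z: "C *\<^sub>v (C *\<^sub>v v) = 0\<^sub>v n"
  shows "C *\<^sub>v v = 0\<^sub>v n"
proof -
  define w where "w = C *\<^sub>v v"
  have w: "w \<in> carrier_vec n" using C v by (simp add: w_def)
  have "C *\<^sub>v conjugate w = conjugate (C *\<^sub>v w)"
    using conjugate_mult_mat_vec[OF C w] real by simp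
  also have "\<dots> = 0\<^sub>v n" using z by (simp add: w_def)
  finally have "conjugate w \<bullet> (C *\<^sub>v v) = 0"
    using transpose_vec_mult_scalar[OF C v, of "conjugate w"] w v sym by simp
  then have "w \<bullet>c w = 0"
    using w comm_scalar_prod[of w n "conjugate w"] by (simp add: w_def)
  then show ?thesis using w by (simp add: w_def)
qed

lemma mat_kernel_pow_Suc:
  fixes C :: "complex mat"
  assumes C: "C \<in> carrier_mat n n" and sym: "transpose_mat C = C" and real: "map_mat conjugate C = C"
  shows "mat_kernel (C ^\<^sub>m Suc k) = mat_kernel C"
proof (induction k)
  case 0
  then show ?case using C by simp
next
  case (Suc k)
  let ?D = "C ^\<^sub>m Suc k"
  have D: "?D \<in> carrier_mat n n" and DC: "?D * C \<in> carrier_mat n n"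
    using pow_carrier_mat[OF C, of "Suc k"] C by (auto simp del: pow_mat.simps)
  have "v \<in> mat_kernel (?D * C) \<longleftrightarrow> v \<in> mat_kernel C" if v: "v \<in> carrier_vec n" for v
  proof -
    have "v \<in> mat_kernel (?D * C) \<longleftrightarrow> C *\<^sub>v v \<in> mat_kernel ?D"
      unfolding mat_kernel[OF DC] mat_kernel[OF D] using C v assoc_mult_mat_vec[OF D C v]
      by (simp del: pow_mat.simps)
    also have "\<dots> \<longleftrightarrow> v \<in> mat_kernel C"
      unfolding Suc using C v mult_mat_vec_twice_eq_0[OF C sym real v] by (auto simp: mat_kernel[OF C])
    finally show ?thesis .
  qed
  then show ?case
    using mat_kernel_carrier[OF DC] mat_kernel_carrier[OF C] by auto
qed

text \<open>Algebraic and geometric multiplicity agree because the Jordan blocks have size one: the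
  algebraic multiplicity is the dimension of the null space of a high power of \<open>A - x I\<close>, and by
  symmetry that null space is the one of \<open>A - x I\<close> itself. The matrix is regarded as a complex one
  so that its characteristic polynomial splits and a Jordan normal form exists.\<close>
lemma order_char_poly_symmetric:
  fixes A :: "real mat"
  assumes A: "A \<in> carrier_mat n n" and sym: "transpose_mat A = A"
  shows "Polynomial.order x (char_poly A) =
         kernel_dim (char_matrix (map_mat complex_of_real A) (complex_of_real x))"
proof -
  let ?A = "map_mat complex_of_real A" and ?x = "complex_of_real x"
  let ?C = "char_matrix ?A ?x"
  have CA: "?A \<in> carrier_mat n n" and C: "?C \<in> carrier_mat n n" using A by auto
  obtain as where "char_poly ?A = (\<Prod>a\<leftarrow>as. [:- a, 1:])"
    using char_poly_factorized[OF CA] by blast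
  then obtain n_as where jnf: "jordan_nf ?A n_as"
    using jordan_nf_exists[OF CA] by blast
  define ns where "ns = map fst (filter (\<lambda>na. snd na = ?x) n_as)"
  interpret of_real: map_poly_inj_idom_divide_hom complex_of_real ..
  have order: "Polynomial.order x (char_poly A) = sum_list ns"
    using jordan_nf_order[OF jnf, of ?x]
    by (simp add: of_real_hom.char_poly_hom[OF A] of_real.order_hom ns_def)
  \<comment> \<open>The exponent \<open>Suc (sum_list ns)\<close> exceeds every block size and is positive.\<close>
  have "min (Suc (sum_list ns)) m = m" if "m \<in> set ns" for m
    using member_le_sum_list[OF that] by simp
  then have "(\<Sum>m\<leftarrow>ns. min (Suc (sum_list ns)) m) = sum_list ns"
    by (metis map_idI)
  then have "kernel_dim (?C ^\<^sub>m Suc (sum_list ns)) = sum_list ns"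
    using dim_gen_eigenspace[OF jnf, of ?x "Suc (sum_list ns)"]
    by (simp add: dim_gen_eigenspace_def ns_def case_prod_unfold del: pow_mat.simps)
  moreover have "A $$ (i, j) = A $$ (j, i)" if "i < n" "j < n" for i j
    using arg_cong[OF sym, of "\<lambda>M. M $$ (j, i)"] that A by simp
  then have "transpose_mat ?C = ?C"
    by (intro eq_matI) (use A in \<open>auto simp: char_matrix_def\<close>)
  moreover have "map_mat conjugate ?C = ?C"
    by (rule eq_matI) (use A in \<open>auto simp: char_matrix_def\<close>)
  ultimately have "sum_list ns = kernel_dim ?C"
    using mat_kernel_pow_Suc[OF C, of "sum_list ns"] C
    by (simp add: kernel_dim_def del: pow_mat.simps)
  then show ?thesis using order by simp
qed

section \<open>Cycles from orbits\<close>

text \<open>Here \<open>q\<close> is the least period. The index is shifted by one because the distinctness of the vertices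
  of a cycle is expressed through the heads of its arcs.\<close>
lemma periodic_orbit_exists:
  assumes fin: "finite S" and ne: "S \<noteq> {}" and f: "\<And>v. v \<in> S \<Longrightarrow> f v \<in> S"
  obtains v q where "v \<in> S" "0 < q" "(f ^^ q) v = v"
    "inj_on (\<lambda>i. (f ^^ Suc i) v) {..<q}"
proof -
  obtain u where u: "u \<in> S" using ne by blast
  have orbit: "(f ^^ i) u \<in> S" for i by (induction i) (use u f in auto)
  then have "\<not> inj (\<lambda>i. (f ^^ i) u)"
    using fin finite_imageD[of "\<lambda>i. (f ^^ i) u" UNIV] finite_subset[of "range (\<lambda>i. (f ^^ i) u)" S]
    by (auto simp: image_subset_iff)
  then obtain i j where ij: "i < j" "(f ^^ i) u = (f ^^ j) u"
    unfolding inj_def by (metis (no_types, lifting) linorder_neqE_nat)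
  define v where "v = (f ^^ i) u"
  have "(f ^^ (j - i)) v = (f ^^ (j - i + i)) u" by (simp only: v_def funpow_add o_apply)
  then have per: "0 < j - i \<and> (f ^^ (j - i)) v = v"
    using ij by (simp add: v_def)
  define q where "q = (LEAST k. 0 < k \<and> (f ^^ k) v = v)"
  have q: "0 < q" "(f ^^ q) v = v"
    using LeastI[of "\<lambda>k. 0 < k \<and> (f ^^ k) v = v", OF per] by (auto simp: q_def)
  have least: "(f ^^ k) v \<noteq> v" if "0 < k" "k < q" for k
    using not_less_Least[of k "\<lambda>k. 0 < k \<and> (f ^^ k) v = v"] that by (auto simp: q_def)
  have "(f ^^ Suc a) v \<noteq> (f ^^ Suc b) v" if ab: "a < b" "b < q" for a b
  proof
    assume eq: "(f ^^ Suc a) v = (f ^^ Suc b) v"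
    have "(f ^^ (q - Suc b + Suc a)) v = (f ^^ (q - Suc b)) ((f ^^ Suc a) v)"
      by (simp only: funpow_add o_apply)
    also have "\<dots> = (f ^^ (q - Suc b + Suc b)) v"
      by (simp only: funpow_add o_apply eq)
    also have "\<dots> = v" using ab q by simp
    finally show False using least[of "q - Suc b + Suc a"] ab by linarith
  qed
  then have "inj_on (\<lambda>i. (f ^^ Suc i) v) {..<q}"
    by (intro inj_onI) (metis lessThan_iff linorder_neqE_nat)
  then show thesis using that[of v q] orbit[of i] q by (simp add: v_def)
qed

text \<open>A periodic orbit of \<open>f\<close> is a closed walk without repeated vertices. Its period is neither 1
  nor 2, since either would give \<open>f (f v) = v\<close>, so it is a genuine undirected cycle.\<close>
lemma not_forest_if_successor:
  assumes "wf_digraph H" and fin: "finite S" and ne: "S \<noteq> {}"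
    and closed: "\<And>v. v \<in> S \<Longrightarrow> f v \<in> S"
    and adj: "\<And>v. v \<in> S \<Longrightarrow> (v, f v) \<in> arcs_ends H"
    and no_return: "\<And>v. v \<in> S \<Longrightarrow> f (f v) \<noteq> v"
  shows "\<not> is_forest H"
proof -
  interpret wf_digraph H by fact
  obtain v q where v: "v \<in> S" and q: "0 < q" "(f ^^ q) v = v"
    and inj: "inj_on (\<lambda>i. (f ^^ Suc i) v) {..<q}"
    by (rule periodic_orbit_exists[OF fin ne closed])
  have orbit: "(f ^^ i) v \<in> S" for i by (induction i) (use v closed in auto)
  have "\<forall>i. \<exists>e \<in> arcs H. tail H e = (f ^^ i) v \<and> head H e = (f ^^ Suc i) v"
    using adj[OF orbit] by (fastforce simp: arcs_ends_conv)
  then obtain e where e: "\<And>i. e i \<in> arcs H" "\<And>i. tail H (e i) = (f ^^ i) v"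
    "\<And>i. head H (e i) = (f ^^ Suc i) v" by metis
  let ?p = "map e [0..<q]"
  have "cas ((f ^^ i) v) (map e [i..<i + k]) ((f ^^ (i + k)) v)" for i k
  proof (induction k arbitrary: i)
    case (Suc k)
    then show ?case using Suc[of "Suc i"] by (simp add: upt_conv_Cons e del: upt_Suc)
  qed simp
  from this[of 0 q] have cas: "cas v ?p v" by (simp add: q)
  have "v \<in> verts H" using e(1,2)[of 0] tail_in_verts by fastforce
  then have "awalk v ?p v" using cas e(1) by (auto simp: awalk_def)
  moreover have "distinct (tl (awalk_verts v ?p))"
    using inj q by (simp add: awalk_verts_conv'[OF cas] distinct_map comp_def e atLeast0LessThan)
  ultimately have "cycle ?p" using q by (auto simp: cycle_def)
  moreover have "q \<noteq> 1" "q \<noteq> 2"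
    using q no_return[OF v] by (auto simp: numeral_2_eq_2)
  then have "3 \<le> length ?p" using q by simp
  ultimately show ?thesis unfolding is_forest_def by blast
qed

section \<open>Null vectors on a forest\<close>

text \<open>The contradiction comes from a vertex map \<open>f\<close>. An index \<open>i\<close> of a path is white if the vector is
  nonzero at the vertex there, a path is active if it has a white index, and \<open>m W\<close> is the first white
  index of \<open>W\<close>. On an active path \<open>f\<close> moves one step towards the head as long as the index is at
  least \<open>m W\<close>, and from index \<open>m W - 1\<close> it jumps to a white vertex of another path. A jump
  is followed by a backward step inside the new path, so \<open>f\<close> never undoes its last move.\<close>
lemma null_vector_zero_of_path_heads:
  fixes a :: "'v \<Rightarrow> 'v \<Rightarrow> 'c :: ring_no_zero_divisors"
  assumes H: "wf_digraph H" "finite (verts H)" and forest: "is_forest H"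
    and part: "partition_on (verts H) C"
    and path: "\<And>W. W \<in> C \<Longrightarrow> distinct (p W) \<and> set (p W) = W"
    and path_adj: "\<And>W i j. W \<in> C \<Longrightarrow> i < length (p W) \<Longrightarrow> j < length (p W) \<Longrightarrow>
          (p W ! i, p W ! j) \<in> arcs_ends H \<longleftrightarrow> j = Suc i \<or> i = Suc j"
    and a: "\<And>u v. u \<in> verts H \<Longrightarrow> v \<in> verts H \<Longrightarrow> u \<noteq> v \<Longrightarrow> a u v \<noteq> 0 \<longleftrightarrow> (u, v) \<in> arcs_ends H"
    and null: "\<And>u. u \<in> verts H \<Longrightarrow> (\<Sum>v\<in>verts H. a u v * x v) = 0"
    and heads: "\<And>W. W \<in> C \<Longrightarrow> x (hd (p W)) = 0"
    and v: "v \<in> verts H"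
  shows "x v = 0"
proof (rule ccontr)
  assume xv: "x v \<noteq> 0"
  define white where "white = (\<lambda>W i. i < length (p W) \<and> x (p W ! i) \<noteq> 0)"
  define active where "active = {W \<in> C. \<exists>i. white W i}"
  define m where "m = (\<lambda>W. LEAST i. white W i)"
  have m: "white W (m W)" if "W \<in> active" for W
    using that LeastI_ex[of "white W"] by (auto simp: active_def m_def)
  have m_le: "m W \<le> i" if "white W i" for W i
    using that by (auto simp: m_def intro: Least_le)
  have m_pos: "0 < m W" if "W \<in> active" for W
    using m[OF that] heads[of W] that
    by (cases "m W") (auto simp: white_def active_def hd_conv_nth)
  have in_verts: "p W ! i \<in> verts H" if "W \<in> C" "i < length (p W)" for W i
    using that path part partition_onD1 nth_mem by fastforce
  have same: "W = W' \<and> i = j"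
    if "W \<in> C" "W' \<in> C" "i < length (p W)" "j < length (p W')" "p W ! i = p W' ! j" for W W' i j
  proof -
    have "W = W'"
      using that path[of W] path[of W'] part[THEN partition_onD2] nth_mem
      by (metis disjointD disjoint_iff)
    then show ?thesis using that path[of W] by (simp add: nth_eq_iff_index_eq)
  qed
  have cover: "\<exists>W\<in>C. \<exists>i<length (p W). p W ! i = u" if "u \<in> verts H" for u
    using that part[THEN partition_onD1] path by (metis UnionE in_set_conv_nth)
  have jump: "\<exists>W'\<in>active. \<exists>k. W' \<noteq> W \<and> white W' k \<and>
      (p W ! (m W - 1), p W' ! k) \<in> arcs_ends H" if W: "W \<in> active" for W
  proof -
    let ?u = "p W ! (m W - 1)" and ?t = "p W ! m W"
    have WC: "W \<in> C" and len: "m W < length (p W)" and xt: "x ?t \<noteq> 0"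
      using W m[OF W] by (auto simp: active_def white_def)
    have xu: "x ?u = 0"
    proof (rule ccontr)
      assume "x ?u \<noteq> 0"
      then have "white W (m W - 1)" using len by (simp add: white_def)
      then show False using m_le m_pos[OF W] by fastforce
    qed
    have u: "?u \<in> verts H" and t: "?t \<in> verts H" using in_verts[OF WC] len by auto
    have "(?u, ?t) \<in> arcs_ends H" using path_adj[OF WC] len m_pos[OF W] by auto
    then have "a ?u ?t * x ?t \<noteq> 0" using a[OF u t] xt xu by force
    moreover have "a ?u ?t * x ?t + (\<Sum>w\<in>verts H - {?t}. a ?u w * x w) = 0"
      using null[OF u] by (simp add: sum.remove[OF H(2) t])
    ultimately have "(\<Sum>w\<in>verts H - {?t}. a ?u w * x w) \<noteq> 0" by auto
    then obtain w where w: "w \<in> verts H" "w \<noteq> ?t" "a ?u w \<noteq> 0" "x w \<noteq> 0"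
      by (rule sum.not_neutral_contains_not_neutral) auto
    then have uw: "(?u, w) \<in> arcs_ends H" using a[OF u w(1)] xu by auto
    obtain W' k where k: "W' \<in> C" "k < length (p W')" "p W' ! k = w" using cover[OF w(1)] by blast
    have white: "white W' k" using k w by (simp add: white_def)
    have "W' \<noteq> W"
    proof
      assume "W' = W"
      \<comment> \<open>On an induced path the neighbours of index \<open>m W - 1\<close> are \<open>m W\<close>, which is excluded, and
        \<open>m W - 2\<close>, where the vector is zero.\<close>
      with k uw path_adj[OF WC, of "m W - 1" k] len m_pos[OF W]
      have "k = m W \<or> Suc k < m W" by fastforce
      then show False using m_le[OF white] k w \<open>W' = W\<close> by auto
    qed
    then show ?thesis using k uw white by (auto simp: active_def)
  qed
  then obtain J K where jump: "\<And>W. W \<in> active \<Longrightarrow> J W \<in> active \<and> J W \<noteq> W \<and> white (J W) (K W) \<and>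
      (p W ! (m W - 1), p (J W) ! K W) \<in> arcs_ends H" by metis
  define S where "S = {p W ! j | W j. W \<in> active \<and> m W \<le> Suc j \<and> j < length (p W)}"
  \<comment> \<open>Each vertex has a unique position in the cover, so \<open>f\<close> may be prescribed by positions.\<close>
  have "\<exists>f. \<forall>W j. W \<in> C \<longrightarrow> j < length (p W) \<longrightarrow>
      f (p W ! j) = (if m W \<le> j then p W ! (j - 1) else p (J W) ! K W)"
  proof -
    define pos where "pos = (\<lambda>u. SOME (W, j). W \<in> C \<and> j < length (p W) \<and> p W ! j = u)"
    have "pos (p W ! j) = (W, j)" if "W \<in> C" "j < length (p W)" for W j
      unfolding pos_def by (rule some_equality) (use that same in auto)
    then show ?thesis
      by (intro exI[of _ "\<lambda>u. case pos u of (W, j) \<Rightarrow>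
            if m W \<le> j then p W ! (j - 1) else p (J W) ! K W"]) auto
  qed
  then obtain f where f: "\<And>W j. W \<in> C \<Longrightarrow> j < length (p W) \<Longrightarrow>
      f (p W ! j) = (if m W \<le> j then p W ! (j - 1) else p (J W) ! K W)" by blast
  have active: "W \<in> C" if "W \<in> active" for W using that by (simp add: active_def)
  have finS: "finite S"
    by (rule finite_subset[OF _ H(2)]) (auto simp: S_def active intro: in_verts)
  have neS: "S \<noteq> {}"
  proof -
    obtain W j where W: "W \<in> C" "j < length (p W)" "p W ! j = v" using cover[OF v] by blast
    then have "white W j" using xv by (simp add: white_def)
    then have "v \<in> S" using W m_le by (fastforce simp: S_def active_def)
    then show ?thesis by blast
  qed
  have step: "f u \<in> S \<and> (u, f u) \<in> arcs_ends H \<and> f (f u) \<noteq> u" if uS: "u \<in> S" for u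
  proof -
    obtain W j where u: "u = p W ! j" and W: "W \<in> active" "m W \<le> Suc j" "j < length (p W)"
      using uS by (auto simp: S_def)
    note fu = f[OF active[OF W(1)] W(3), folded u]
    note J = jump[OF W(1)]
    have K: "K W < length (p (J W))" "m (J W) \<le> K W"
      using J m_le by (auto simp: white_def)
    have fJ: "f (p (J W) ! K W) = p (J W) ! (K W - 1)"
      using f[OF active K(1)] J K(2) by auto
    show ?thesis
    proof (cases "m W \<le> j")
      case True
      have j: "0 < j" using True m_pos[OF W(1)] by simp
      have fu: "f u = p W ! (j - 1)" using fu True by simp
      have "f u \<in> S" unfolding S_def using W True j fu
        by (auto intro!: exI[of _ W] exI[of _ "j - 1"])
      moreover have "(u, f u) \<in> arcs_ends H"
        using path_adj[OF active[OF W(1)], of j "j - 1"] W j u fu by auto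
      moreover have "f (f u) \<noteq> u"
      proof (cases "m W \<le> j - 1")
        case True
        have len: "j - 1 < length (p W)" "j - 1 - 1 < length (p W)" using W by linarith+
        then have "f (f u) = p W ! (j - 1 - 1)"
          using f[OF active[OF W(1)] len(1)] True fu by simp
        then show ?thesis
          using same[OF active[OF W(1)] active[OF W(1)] len(2) W(3)] j u by auto
      next
        case False
        then have "f (f u) = p (J W) ! K W"
          using f[OF active[OF W(1)], of "j - 1"] W fu by auto
        then show ?thesis
          using J K(1) u W same[OF active active[OF W(1)], of "J W" "K W" j] by auto
      qed
      ultimately show ?thesis by blast
    next
      case False
      then have j: "j = m W - 1" using W by simp
      have fu: "f u = p (J W) ! K W" using fu False by simp
      have "f u \<in> S" unfolding S_def using J K fu by auto
      moreover have "(u, f u) \<in> arcs_ends H" using J j u fu by simp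
      moreover have "f (f u) \<noteq> u"
      proof
        have len: "K W - 1 < length (p (J W))" using K(1) by linarith
        have JA: "J W \<in> active" using J by blast
        assume "f (f u) = u"
        then have "J W = W"
          using same[OF active[OF JA] active[OF W(1)] len W(3)] fu fJ u by simp
        then show False using J by blast
      qed
      ultimately show ?thesis by blast
    qed
  qed
  have "\<not> is_forest H"
    by (rule not_forest_if_successor[where f = f, OF H(1) finS neS]) (simp_all add: step)
  then show False using forest by contradiction
qed

section \<open>Bounding the maximum multiplicity\<close>

lemma path_cover_enumeration:
  assumes "graph H" and cover: "is_path_cover H C"
  obtains p where "\<And>W. W \<in> C \<Longrightarrow> p W \<noteq> [] \<and> distinct (p W) \<and> set (p W) = W"
    "\<And>W i j. W \<in> C \<Longrightarrow> i < length (p W) \<Longrightarrow> j < length (p W) \<Longrightarrow>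
       (p W ! i, p W ! j) \<in> arcs_ends H \<longleftrightarrow> j = Suc i \<or> i = Suc j"
proof -
  have "\<exists>q. q \<noteq> [] \<and> distinct q \<and> set q = W \<and> (\<forall>i < length q. \<forall>j < length q.
      (q ! i, q ! j) \<in> arcs_ends H \<longleftrightarrow> j = Suc i \<or> i = Suc j)" if "W \<in> C" for W
  proof -
    obtain q where q: "q \<noteq> []" "distinct q" "set q = W" "\<forall>i < length q. \<forall>j < length q.
      (q ! i, q ! j) \<in> arcs_ends (H \<restriction> W) \<longleftrightarrow> j = Suc i \<or> i = Suc j"
      using cover \<open>W \<in> C\<close> by (auto simp: is_path_cover_def is_path_graph_def)
    have "(u, v) \<in> arcs_ends (H \<restriction> W) \<longleftrightarrow> (u, v) \<in> arcs_ends H" if "u \<in> W" "v \<in> W" for u v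
      using that by (force simp: arcs_ends_conv)
    then show ?thesis using q by (metis nth_mem)
  qed
  then show thesis using that by metis
qed

lemma graph_induce_subgraph:
  assumes "graph G" and "W \<subseteq> verts G"
  shows "graph (G \<restriction> W)"
proof -
  interpret graph G by fact
  have sub: "induced_subgraph (G \<restriction> W) G" using assms(2) by (rule induced_induce)
  show ?thesis
    by (intro graph.intro pseudo_graph.intro digraphI_induced[OF sub]
        induced_graph_imp_graph[OF sub] digraph.axioms(1)[OF digraphI_induced[OF sub]])
qed

lemma graph_matrices_enumeration:
  assumes "A \<in> graph_matrices G"
  obtains g where "bij_betw g (verts G) {..<card (verts G)}"
    "\<And>u v. u \<in> verts G \<Longrightarrow> v \<in> verts G \<Longrightarrow> u \<noteq> v \<Longrightarrow>
       A $$ (g u, g v) \<noteq> 0 \<longleftrightarrow> (u, v) \<in> arcs_ends G"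
proof -
  have A: "A \<in> carrier_mat (card (verts G)) (card (verts G))"
    and "digraph_iso G (matrix_graph A)" using assms by (auto simp: graph_matrices_def)
  then obtain h where h: "pre_digraph.digraph_isomorphism G h" and eq: "matrix_graph A = app_iso h G"
    by (auto simp: digraph_iso_def)
  interpret wf_digraph G using h by (simp add: pre_digraph.digraph_isomorphism_def)
  let ?g = "iso_verts h"
  have "verts (matrix_graph A) = ?g ` verts G" by (simp add: eq)
  then have img: "?g ` verts G = {..<card (verts G)}"
    using A by (simp add: matrix_graph_def atLeast0LessThan)
  then have bij: "bij_betw ?g (verts G) {..<card (verts G)}"
    using h by (simp add: bij_betw_def digraph_isomorphism_def)
  have "A $$ (?g u, ?g v) \<noteq> 0 \<longleftrightarrow> (u, v) \<in> arcs_ends G"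
    if uv: "u \<in> verts G" "v \<in> verts G" "u \<noteq> v" for u v
  proof -
    have "?g u < card (verts G)" "?g v < card (verts G)" "?g u \<noteq> ?g v"
      using img uv h by auto
    then have "A $$ (?g u, ?g v) \<noteq> 0 \<longleftrightarrow> (?g u, ?g v) \<in> arcs_ends (matrix_graph A)"
      using A by (auto simp: matrix_graph_def arcs_ends_conv)
    also have "\<dots> \<longleftrightarrow> (\<exists>e\<in>arcs G. ?g u = ?g (tail G e) \<and> ?g v = ?g (head G e))"
      using h by (auto simp: eq arcs_ends_conv iso_verts_tail iso_verts_head image_iff)
    also have "\<dots> \<longleftrightarrow> (u, v) \<in> arcs_ends G"
      using uv h by (auto simp: arcs_ends_conv image_iff)
    finally show ?thesis .
  qed
  then show thesis using that bij by blast
qed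

text \<open>The coordinates \<open>Z\<close> that force a null vector to vanish are the vertices of \<open>S\<close> and the path heads.
  Passing from \<open>A\<close> to \<open>A - x I\<close> changes only the diagonal, so the nonzero pattern is still that of
  \<open>G\<close>.\<close>
lemma multiplicity_le:
  assumes G: "graph G" and A: "A \<in> graph_matrices G"
    and S: "S \<subseteq> verts G" and forest: "is_forest (G \<restriction> (verts G - S))"
    and cover: "is_path_cover (G \<restriction> (verts G - S)) C"
  shows "Polynomial.order x (char_poly A) \<le> card C + card S"
proof -
  interpret graph G by fact
  let ?n = "card (verts G)" and ?H = "G \<restriction> (verts G - S)"
  let ?C = "char_matrix (map_mat complex_of_real A) (complex_of_real x)"
  have Ac: "A \<in> carrier_mat ?n ?n" and sym: "transpose_mat A = A"
    using A by (auto simp: graph_matrices_def)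
  have Cc: "?C \<in> carrier_mat ?n ?n" using Ac by simp
  obtain g where bij: "bij_betw g (verts G) {..<?n}"
    and g: "\<And>u v. u \<in> verts G \<Longrightarrow> v \<in> verts G \<Longrightarrow> u \<noteq> v \<Longrightarrow>
       A $$ (g u, g v) \<noteq> 0 \<longleftrightarrow> (u, v) \<in> arcs_ends G"
    by (rule graph_matrices_enumeration[OF A]) blast
  interpret H: graph ?H using G by (rule graph_induce_subgraph) simp
  obtain p where p: "\<And>W. W \<in> C \<Longrightarrow> p W \<noteq> [] \<and> distinct (p W) \<and> set (p W) = W"
    and p_adj: "\<And>W i j. W \<in> C \<Longrightarrow> i < length (p W) \<Longrightarrow> j < length (p W) \<Longrightarrow>
       (p W ! i, p W ! j) \<in> arcs_ends ?H \<longleftrightarrow> j = Suc i \<or> i = Suc j"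
    by (rule path_cover_enumeration[OF H.graph_axioms cover]) blast
  have part: "partition_on (verts ?H) C" using cover by (simp add: is_path_cover_def)
  have finC: "finite C" using finite_elements[OF H.finite_verts part] .
  have finS: "finite S" using finite_subset[OF S] by simp
  define Z where "Z = g ` (S \<union> (\<lambda>W. hd (p W)) ` C)"
  have heads: "hd (p W) \<in> verts G - S" if "W \<in> C" for W
    using p[OF that] part that by (metis UnionI hd_in_set induce_subgraph_verts partition_onD1)
  have g_less: "g u < ?n" if "u \<in> verts G" for u using bij that by (auto simp: bij_betw_def)
  have "card Z \<le> card S + card C"
    unfolding Z_def using finC finS
    by (meson card_Un_le card_image_le finite_UnI finite_imageI add_left_mono le_trans)
  moreover have "kernel_dim ?C \<le> card Z"
  proof (rule kernel_dim_le_card_coordinates[OF Cc])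
    show "Z \<subseteq> {..<?n}" using g_less heads S by (auto simp: Z_def)
    fix v assume v: "v \<in> mat_kernel ?C" and zero: "\<And>i. i \<in> Z \<Longrightarrow> v $ i = 0"
    have vc: "v \<in> carrier_vec ?n" and Cv: "?C *\<^sub>v v = 0\<^sub>v ?n" using mat_kernelD[OF Cc v] by auto
    define a where "a = (\<lambda>u w. ?C $$ (g u, g w))"
    define y where "y = (\<lambda>u. v $ g u)"
    have yS: "y u = 0" if "u \<in> S" for u using that zero by (simp add: y_def Z_def)
    have null: "(\<Sum>w\<in>verts ?H. a u w * y w) = 0" if u: "u \<in> verts G" for u
    proof -
      have "(\<Sum>w\<in>verts ?H. a u w * y w) = (\<Sum>w\<in>verts G. a u w * y w)"
        using S by (intro sum.mono_neutral_left) (auto simp: yS)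
      also have "\<dots> = (\<Sum>i<?n. ?C $$ (g u, i) * v $ i)"
        unfolding a_def y_def by (rule sum.reindex_bij_betw[OF bij])
      also have "\<dots> = (?C *\<^sub>v v) $ g u"
        using g_less[OF u] Cc vc by (simp add: scalar_prod_def atLeast0LessThan)
      finally show ?thesis using Cv g_less[OF u] by simp
    qed
    have a: "a u w \<noteq> 0 \<longleftrightarrow> (u, w) \<in> arcs_ends ?H"
      if uw: "u \<in> verts ?H" "w \<in> verts ?H" "u \<noteq> w" for u w
    proof -
      have "g u \<noteq> g w" using uw bij by (auto simp: bij_betw_def inj_on_def)
      then have "a u w = of_real (A $$ (g u, g w))"
        using uw g_less[of u] g_less[of w] Ac by (simp add: a_def char_matrix_def)
      moreover have "(u, w) \<in> arcs_ends ?H \<longleftrightarrow> (u, w) \<in> arcs_ends G"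
        using uw by (force simp: arcs_ends_conv)
      ultimately show ?thesis using g[of u w] uw by simp
    qed
    have yH: "y u = 0" if "u \<in> verts ?H" for u
    proof (rule null_vector_zero_of_path_heads[where H = ?H and a = a and x = y and p = p,
          OF _ _ forest part _ p_adj a _ _ that])
      show "y (hd (p W)) = 0" if "W \<in> C" for W using that zero by (simp add: y_def Z_def)
    qed (use p null H.wf_digraph_axioms in auto)
    show "v = 0\<^sub>v ?n"
    proof (rule eq_vecI)
      fix i assume "i < dim_vec (0\<^sub>v ?n :: complex vec)"
      then have "i \<in> g ` verts G" using bij by (simp add: bij_betw_def)
      then obtain u where u: "u \<in> verts G" "g u = i" by blast
      then have "y u = 0" using yS yH by (cases "u \<in> S") auto
      then show "v $ i = 0\<^sub>v ?n $ i" using u g_less by (auto simp: y_def)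
    qed (use vc in simp)
  qed
  ultimately show ?thesis using order_char_poly_symmetric[OF Ac sym, of x] by simp
qed

theorem theorem3p7:
  fixes G :: "('a, 'b) pre_digraph"
  assumes "graph G"
  shows "max_multiplicity G \<le> T_plus G"
proof -
  let ?H = "\<lambda>S. G \<restriction> (verts G - S)"
  let ?M = "{Polynomial.order x (char_poly A) | A x. A \<in> graph_matrices G \<and> eigenvalue A x}"
  have "\<exists>k S. S \<subseteq> verts G \<and> is_forest (?H S) \<and> k = path_cover_number (?H S) + card S"
    using forest_deletion_exists[of G] by blast
  then have "\<exists>S. S \<subseteq> verts G \<and> is_forest (?H S) \<and> T_plus G = path_cover_number (?H S) + card S"
    unfolding T_plus_def by (rule LeastI_ex)
  then obtain S where S: "S \<subseteq> verts G" "is_forest (?H S)"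
    and T: "T_plus G = path_cover_number (?H S) + card S" by blast
  have "\<exists>k C. is_path_cover (?H S) C \<and> card C = k"
    using path_cover_exists[OF graph_induce_subgraph[OF assms]] by blast
  then have "\<exists>C. is_path_cover (?H S) C \<and> card C = path_cover_number (?H S)"
    unfolding path_cover_number_def by (rule LeastI_ex)
  then obtain C where C: "is_path_cover (?H S) C" "card C = path_cover_number (?H S)" by blast
  have "k \<le> T_plus G" if "k \<in> ?M" for k
    using that multiplicity_le[OF assms _ S C(1)] C(2) T by auto
  then show ?thesis
    unfolding max_multiplicity_def Sup_nat_def using finite_multiplicities[of G]
    by (auto simp: Max_le_iff)
qed

end
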